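(* Let $n\ge 1$ be an integer, $M>0$, $a\in\mathbb{C}$ with $|a|<M$, and let $\beta$ be real with $0<\beta\le (M^2-|a|^2)/M$. Let $p\in\mathcal{H}_\beta[a,n]$. (i) Let $\Omega\subset\mathbb{C}$ be a domain and let $\psi\in\Psi_{n,\beta}(\Omega,M,a)$ with associated domain $D$. If $(p(z),zp'(z),z^2p''(z))\in D$ and $$\psi(p(z),zp'(z),z^2p''(z))\in\Omega\qquad\text{for all }z\in\mathbb{D},$$ then $|p(z)|<M$ for all $z\in\mathbb{D}$. (ii) Let $\psi\in\Psi_{n,\beta}(M,a)$ with associated domain $D$. If $(p(z),zp'(z),z^2p''(z))\in D$ and $$|\psi(p(z),zp'(z),z^2p''(z))|<M\qquad\text{for all }z\in\mathbb{D},$$ then $|p(z)|<M$ for all $z\in\mathbb{D}$.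
   Context: $\mathbb{D}=\{z\in\mathbb{C}:|z|<1\}$. For $a\in\mathbb{C}$, a positive integer $n$ and a fixed real $\beta\ge 0$, $\mathcal{H}_\beta[a,n]$ is the class of analytic functions $p$ in $\mathbb{D}$ of the form $p(z)=a+\beta z^n+p_{n+1}z^{n+1}+\cdots$. For a domain $\Omega\subset\mathbb{C}$, the class $\Psi_{n,\beta}(\Omega,M,a)$ consists of those functions $\psi:\mathbb{C}^3\to\mathbb{C}$ that are continuous in a domain $D\subset\mathbb{C}^3$ (the associated domain) with $(a,0,0)\in D$ and $\psi(a,0,0)\in\Omega$, and that satisfy $\psi(r,s,t)\notin\Omega$ whenever $(r,s,t)\in D$, $$r=Me^{i\theta},\qquad s=m\,\frac{M|M-\overline{a}e^{i\theta}|^2}{M^2-|a|^2}\,e^{i\theta},\qquad \operatorname{Re}\left(\frac{t}{s}+1\right)\ge m\,\frac{|M-\overline{a}e^{i\theta}|^2}{M^2-|a|^2},$$ where $\theta\in\mathbb{R}$ and $m$ is a real number with $m\ge n+\dfrac{M^2-|a|^2-M\beta}{M^2-|a|^2+M\beta}$. $\Psi_{n,\beta}(M,a)$ denotes the class $\Psi_{n,\beta}(\Omega,M,a)$ with $\Omega=\{w\in\mathbb{C}:|w|<M\}$. *)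

theory Defs
  imports "HOL-Complex_Analysis.Complex_Analysis"
begin

definition is_domain :: "'a::topological_space set \<Rightarrow> bool" where
  "is_domain S \<longleftrightarrow> open S \<and> connected S \<and> S \<noteq> {}"

definition \<H> :: "real \<Rightarrow> complex \<Rightarrow> nat \<Rightarrow> (complex \<Rightarrow> complex) set" where
  "\<H> \<beta> a n = {p. p holomorphic_on ball 0 1 \<and>
     (\<exists>c :: nat \<Rightarrow> complex. \<forall>z\<in>ball 0 1.
        (\<lambda>k. c k * z ^ (n + 1 + k)) sums (p z - (a + of_real \<beta> * z ^ n)))}"

text \<open>The associated domain \<open>D\<close> is part of the data of a member of the class, so it is an explicit
  argument: \<open>\<psi> \<in> \<Psi> n \<beta> \<Omega> M a D\<close> means that \<open>\<psi>\<close> belongs to the class with associated domain \<open>D\<close>.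
  Values of \<open>\<psi>\<close> outside \<open>D\<close> are unconstrained.

  The quotient \<open>t / s\<close> is only formed for \<open>s \<noteq> 0\<close>: if \<open>n \<ge> 1\<close>, \<open>cmod a < M\<close> and
  \<open>0 \<le> \<beta> \<le> (M\<^sup>2 - (cmod a)\<^sup>2) / M\<close>, then \<open>m \<ge> n \<ge> 1\<close> and \<open>M - cnj a * cis \<theta> \<noteq> 0\<close>.\<close>

definition \<Psi> :: "nat \<Rightarrow> real \<Rightarrow> complex set \<Rightarrow> real \<Rightarrow> complex \<Rightarrow> (complex \<times> complex \<times> complex) set
    \<Rightarrow> (complex \<times> complex \<times> complex \<Rightarrow> complex) set" where
  "\<Psi> n \<beta> \<Omega> M a D = {\<psi>.
     is_domain D \<and> continuous_on D \<psi> \<and> (a, 0, 0) \<in> D \<and> \<psi> (a, 0, 0) \<in> \<Omega> \<and>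
     (\<forall>r s t. \<forall>\<theta> m :: real.
        (r, s, t) \<in> D \<longrightarrow>
        m \<ge> real n + (M\<^sup>2 - (cmod a)\<^sup>2 - M * \<beta>) / (M\<^sup>2 - (cmod a)\<^sup>2 + M * \<beta>) \<longrightarrow>
        r = of_real M * cis \<theta> \<longrightarrow>
        s = of_real (m * (M * (cmod (of_real M - cnj a * cis \<theta>))\<^sup>2 / (M\<^sup>2 - (cmod a)\<^sup>2))) * cis \<theta> \<longrightarrow>
        Re (t / s + 1) \<ge> m * ((cmod (of_real M - cnj a * cis \<theta>))\<^sup>2 / (M\<^sup>2 - (cmod a)\<^sup>2)) \<longrightarrow>
        \<psi> (r, s, t) \<notin> \<Omega>)}"

definition \<Psi>_disc :: "nat \<Rightarrow> real \<Rightarrow> real \<Rightarrow> complex \<Rightarrow> (complex \<times> complex \<times> complex) set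
    \<Rightarrow> (complex \<times> complex \<times> complex \<Rightarrow> complex) set" where
  "\<Psi>_disc n \<beta> M a D = \<Psi> n \<beta> {w. cmod w < M} M a D"

end

(* Take a point z0 of least modulus with |p z0| = M and put r = p z0, s = z0 p'(z0),
   t = z0^2 p''(z0). The function |p (z0 e^(i x))|^2 has a maximum at x = 0: its first derivative
   there gives s = k r with k real, its second one Re (t/s + 1) \<ge> k. Composing p with the Moebius
   map of the disc of radius M onto the unit disc that sends a to 0 yields w with a zero of order n
   at 0, and applying the Schwarz-Pick lemma to w / z^n bounds |w| along the radius to z0 by
   x^n (b + x) / (1 + b x), b = |z0|^n M \<beta> / (M^2 - |a|^2), with equality at x = 1. Comparing
   derivatives at x = 1 bounds k from below, so that (r, s, t) is excluded by admissibility. *)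

theory Submission
  imports Defs
begin

section \<open>First- and second-order conditions at a maximum of the modulus on a circle\<close>

lemma has_real_derivative_cmod_power2:
  assumes "(f has_vector_derivative D) (at x)"
  shows "((\<lambda>x. (cmod (f x))\<^sup>2) has_real_derivative 2 * Re (cnj (f x) * D)) (at x)"
proof -
  have "((\<lambda>x. (Re (f x))\<^sup>2 + (Im (f x))\<^sup>2) has_real_derivative 2 * Re (cnj (f x) * D)) (at x)"
    by (rule derivative_eq_intros assms refl)+ (simp add: algebra_simps)
  then show ?thesis
    by (simp add: cmod_power2)
qed

text \<open>If \<open>h''\<close> were positive, \<open>h'\<close> would be positive just to the
  right of its zero \<open>x\<close>, and \<open>h\<close> would rise there above its
  maximum.\<close>

lemma second_derivative_nonpos_at_max:
  fixes h :: "real \<Rightarrow> real"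
  assumes h: "\<And>t. (h has_real_derivative h' t) (at t)"
    and h': "(h' has_real_derivative h'') (at x)"
    and max: "\<And>t. h t \<le> h x"
  shows "h' x = 0" and "h'' \<le> 0"
proof -
  show h'0: "h' x = 0"
    using DERIV_local_max[OF h, of 1] max by simp
  show "h'' \<le> 0"
  proof (rule ccontr)
    assume "\<not> h'' \<le> 0"
    then obtain d where d: "d > 0" "\<And>e. 0 < e \<Longrightarrow> e < d \<Longrightarrow> h' x < h' (x + e)"
      using DERIV_pos_inc_right[OF h'] by auto
    have "h x < h (x + d)"
    proof (rule DERIV_pos_imp_increasing_open[where f = h])
      show "\<exists>y. DERIV h t :> y \<and> y > 0" if "x < t" "t < x + d" for t
        using d(2)[of "t - x"] that h h'0 by auto
      show "continuous_on {x..x + d} h"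
        using h by (meson DERIV_isCont continuous_at_imp_continuous_on)
    qed (use d in auto)
    with max[of "x + d"] show False
      by simp
  qed
qed

text \<open>Along the circle, the second derivative of f(z exp(i t)) at t = 0 is -(z f' + z^2 f''),
  so these are the conditions h' = 0 and h'' \<le> 0 for h(t) = |f(z exp(i t))|^2. Once z f' = k f
  with k > 0 and f(z) nonzero, the second one becomes Re (z f'' / f' + 1) \<ge> k.\<close>

lemma circle_max_derivatives:
  assumes f: "f holomorphic_on S" and S: "open S" and sub: "cball 0 (cmod z) \<subseteq> S"
    and max: "\<And>w. cmod w = cmod z \<Longrightarrow> cmod (f w) \<le> cmod (f z)"
  shows "Im (cnj (f z) * (z * deriv f z)) = 0"
    and "(cmod (z * deriv f z))\<^sup>2 \<le> Re (cnj (f z) * (z * deriv f z + z\<^sup>2 * deriv (deriv f) z))"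
proof -
  define e where "e t = z * exp (\<i> * of_real t)" for t :: real
  have e: "(e has_vector_derivative \<i> * e t) (at t)" for t
    unfolding e_def
    by (rule derivative_eq_intros has_vector_derivative_real_field | simp)+
  have [simp]: "cmod (e t) = cmod z" for t
    by (simp add: e_def norm_mult)
  have eS: "e t \<in> S" for t
    using sub by (auto simp: subset_iff)
  have e0: "e 0 = z"
    by (simp add: e_def)
  have f': "deriv f holomorphic_on S"
    using f S by (rule holomorphic_deriv)
  have P: "((\<lambda>t. f (e t)) has_vector_derivative \<i> * e t * deriv f (e t)) (at t)" for t
    using field_vector_diff_chain_at[OF e holomorphic_derivI[OF f S eS]] by (simp add: o_def)
  have P': "((\<lambda>t. deriv f (e t)) has_vector_derivative \<i> * e t * deriv (deriv f) (e t)) (at t)" for t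
    using field_vector_diff_chain_at[OF e holomorphic_derivI[OF f' S eS]] by (simp add: o_def)
  define h where "h t = (cmod (f (e t)))\<^sup>2" for t
  define h' where "h' t = 2 * Re (cnj (f (e t)) * (\<i> * e t * deriv f (e t)))" for t
  have h: "(h has_real_derivative h' t) (at t)" for t
    unfolding h_def h'_def by (rule has_real_derivative_cmod_power2[OF P])
  have h': "(h' has_real_derivative
     2 * ((cmod (z * deriv f z))\<^sup>2 - Re (cnj (f z) * (z * deriv f z + z\<^sup>2 * deriv (deriv f) z)))) (at 0)"
    unfolding h'_def
    apply (rule derivative_eq_intros e P P' has_vector_derivative_cnj refl)+
    unfolding cmod_power2
    apply (simp add: e0 power2_eq_square algebra_simps)
    done
  have "h t \<le> h 0" for t
    using max by (simp add: h_def e0)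
  note * = second_derivative_nonpos_at_max[OF h h' this]
  show "Im (cnj (f z) * (z * deriv f z)) = 0"
    using *(1) by (simp add: h'_def e0 algebra_simps)
  show "(cmod (z * deriv f z))\<^sup>2 \<le> Re (cnj (f z) * (z * deriv f z + z\<^sup>2 * deriv (deriv f) z))"
    using *(2) by simp
qed

section \<open>Growth of bounded analytic functions on the unit disc\<close>

text \<open>By the Schwarz lemma for the Moebius transform of \<open>g\<close> that vanishes at 0,
  \<open>g z\<close> lies in the pseudohyperbolic disc of radius |z| about \<open>g 0\<close>; the
  bound is the largest modulus in that disc.\<close>

lemma Schwarz_Pick_growth:
  assumes g: "g holomorphic_on ball 0 1" and g1: "\<And>z. cmod z < 1 \<Longrightarrow> cmod (g z) \<le> 1"
    and g0: "cmod (g 0) < 1" and z: "cmod z < 1"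
  shows "cmod (g z) \<le> (cmod (g 0) + cmod z) / (1 + cmod (g 0) * cmod z)"
proof -
  define b where "b = g 0"
  \<comment> \<open>The Moebius map requires strict inequality. A point where |g| = 1 would make
    \<open>g\<close> constant by the maximum modulus principle, against |g 0| < 1.\<close>
  have lt: "cmod (g w) < 1" if "cmod w < 1" for w
  proof (rule ccontr)
    assume "\<not> cmod (g w) < 1"
    with g1[OF that] have "cmod (g w) = 1" by simp
    then have "g constant_on ball 0 1"
      using g1 that by (intro maximum_modulus_principle[OF g, of "ball 0 1" w]) auto
    then have "g w = g 0"
      using that by (auto simp: constant_on_def)
    with g0 \<open>cmod (g w) = 1\<close> show False by simp
  qed
  define T where "T w = Moebius_function 0 b (g w)" for w
  have "T holomorphic_on ball 0 1"
    unfolding T_def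
    by (rule holomorphic_on_compose_gen[OF g Moebius_function_holomorphic, unfolded o_def])
      (use lt g0 in \<open>auto simp: b_def\<close>)
  then have "cmod (T z) \<le> cmod z"
  proof (rule Schwarz_Lemma(1))
    show "cmod (T w) < 1" if "cmod w < 1" for w
      unfolding T_def using g0 lt[OF that] by (intro Moebius_function_norm_lt_1) (auto simp: b_def)
  qed (use z in \<open>auto simp: T_def b_def Moebius_function_eq_zero\<close>)
  moreover have "1 - cnj b * g z \<noteq> 0"
  proof
    assume "1 - cnj b * g z = 0"
    then have "cmod (cnj b * g z) = 1" by (metis eq_iff_diff_eq_0 norm_one)
    moreover have "cmod (cnj b * g z) < 1 * 1"
      unfolding norm_mult using g0 lt[OF z] by (intro mult_strict_mono') (auto simp: b_def)
    ultimately show False by simp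
  qed
  ultimately have "cmod (g z - b) \<le> cmod z * cmod (1 - cnj b * g z)"
    by (simp add: T_def Moebius_function_simple norm_divide divide_simps mult.commute)
  define R where "R = Re (cnj b * g z)"
  from \<open>cmod (g z - b) \<le> _\<close> have "(cmod (g z - b))\<^sup>2 \<le> (cmod z)\<^sup>2 * (cmod (1 - cnj b * g z))\<^sup>2"
    by (metis norm_ge_zero power_mono power_mult_distrib)
  moreover have "(cmod (g z - b))\<^sup>2 = (cmod (g z))\<^sup>2 + (cmod b)\<^sup>2 - 2 * R"
    unfolding cmod_power2 R_def by (simp add: power2_eq_square algebra_simps)
  moreover have "(cmod (1 - cnj b * g z))\<^sup>2 = 1 + (cmod b)\<^sup>2 * (cmod (g z))\<^sup>2 - 2 * R"
    unfolding cmod_power2 R_def by (simp add: power2_eq_square algebra_simps)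
  ultimately have "(cmod (g z))\<^sup>2 + (cmod b)\<^sup>2 - 2 * R
      \<le> (cmod z)\<^sup>2 * (1 + (cmod b)\<^sup>2 * (cmod (g z))\<^sup>2 - 2 * R)"
    by simp
  \<comment> \<open>Collecting terms leaves \<open>R\<close> with the factor 2 (1 - |z|^2) \<ge> 0
    on the larger side; replacing it by |b| |g z| turns the inequality into one between two squares
    of real numbers.\<close>
  moreover have "(1 - (cmod z)\<^sup>2) * R \<le> (1 - (cmod z)\<^sup>2) * (cmod b * cmod (g z))"
    using z complex_Re_le_cmod[of "cnj b * g z"]
    by (intro mult_left_mono) (auto simp: R_def norm_mult power_le_one)
  ultimately have "(cmod (g z) - cmod b)\<^sup>2 \<le> (cmod z * (1 - cmod b * cmod (g z)))\<^sup>2"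
    by (simp add: power2_eq_square algebra_simps)
  moreover have "cmod b * cmod (g z) \<le> 1"
    using g0 g1[OF z] by (intro mult_le_one) (auto simp: b_def)
  ultimately have "cmod (g z) - cmod b \<le> cmod z * (1 - cmod b * cmod (g z))"
    using z by (auto intro: power2_le_imp_le)
  moreover have "1 + cmod b * cmod z > 0"
    by (intro add_pos_nonneg) auto
  ultimately show ?thesis
    unfolding b_def by (simp add: pos_le_divide_eq algebra_simps)
qed

section \<open>The lower bound for the derivative at a first boundary point\<close>

text \<open>The prescribed coefficient of z^n becomes the value at 0 of a holomorphic factor
  \<open>q\<close>, which is the form the Schwarz-Pick argument uses.\<close>

lemma \<H>_factor:
  assumes "p \<in> \<H> \<beta> a n"
  obtains q where "q holomorphic_on ball 0 1" and "q 0 = of_real \<beta>"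
    and "\<And>z. z \<in> ball 0 1 \<Longrightarrow> p z = a + z ^ n * q z"
proof -
  from assms obtain c :: "nat \<Rightarrow> complex" where c:
    "\<And>z. z \<in> ball 0 1 \<Longrightarrow> (\<lambda>k. c k * z ^ (n + 1 + k)) sums (p z - (a + of_real \<beta> * z ^ n))"
    unfolding \<H>_def by blast
  \<comment> \<open>The quotient has a removable singularity at 0; its value there must be
    \<open>c 0\<close>, the sum of the series at 0.\<close>
  define s where "s z = (if z = 0 then c 0 else (p z - (a + of_real \<beta> * z ^ n)) / z ^ (n + 1))" for z
  have s: "(\<lambda>k. c k * z ^ k) sums s z" if "z \<in> ball 0 1" for z
  proof (cases "z = 0")
    case True
    then show ?thesis
      using powser_sums_zero[of c] by (simp add: s_def)
  next
    case False
    then show ?thesis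
      using sums_divide[OF c[OF that], of "z ^ (n + 1)"]
      by (simp add: s_def power_add)
  qed
  then have "s holomorphic_on ball 0 1"
    by (intro power_series_holomorphic[of 0 1 c]) simp
  show thesis
  proof
    show "(\<lambda>z. of_real \<beta> + z * s z) holomorphic_on ball 0 1"
      by (intro holomorphic_intros \<open>s holomorphic_on _\<close>)
    show "p z = a + z ^ n * (of_real \<beta> + z * s z)" if "z \<in> ball 0 1" for z
    proof (cases "z = 0")
      case True
      then show ?thesis
        using c[of 0] sums_unique2[OF sums_zero] by (fastforce simp: algebra_simps)
    next
      case False
      then show ?thesis
        by (simp add: s_def field_simps)
    qed
  qed simp
qed


text \<open>The function w = M (p - a) / (M^2 - cnj a p) has modulus 1 at \<open>z0\<close> and
  stays below an explicit majorant on the radius, so |w| must grow at \<open>z0\<close> at least as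
  fast as the majorant. The conclusion is this comparison in terms of \<open>p\<close>, with
  denominators partly cleared.\<close>

lemma boundary_derivative_bound:
  fixes p q :: "complex \<Rightarrow> complex" and M :: real
  assumes q: "q holomorphic_on ball 0 1"
    and p: "\<And>z. z \<in> ball 0 1 \<Longrightarrow> p z = a + z ^ n * q z"
    and n: "n \<ge> 1" and a: "cmod a < M"
    and z0: "cmod z0 < 1"
    and le: "\<And>z. cmod z \<le> cmod z0 \<Longrightarrow> cmod (p z) \<le> M"
    and eq: "cmod (p z0) = M"
    and q0: "M * cmod (q 0) \<le> M\<^sup>2 - (cmod a)\<^sup>2"
  shows "(real n + (M\<^sup>2 - (cmod a)\<^sup>2 - M * cmod (q 0)) / (M\<^sup>2 - (cmod a)\<^sup>2 + M * cmod (q 0)))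
      * (cmod (of_real (M\<^sup>2) - cnj a * p z0))\<^sup>2
    \<le> (M\<^sup>2 - (cmod a)\<^sup>2) * Re (cnj (p z0) * (z0 * deriv p z0))"
proof -
  define A where "A = M\<^sup>2 - (cmod a)\<^sup>2"
  have M: "M > 0"
    using a norm_ge_zero[of a] by linarith
  have A: "A > 0"
    using a by (simp add: A_def power_strict_mono)
  have scale: "z0 * x \<in> ball 0 1" "cmod (z0 * x) \<le> cmod z0" if "cmod x \<le> 1" for x
    using z0 that mult_left_mono[of "cmod x" 1 "cmod z0"] by (auto simp: norm_mult)
  have p_hol: "p holomorphic_on ball 0 1"
    by (subst holomorphic_cong[OF refl p]) (auto intro!: holomorphic_intros q)
  \<comment> \<open>Rescaling by \<open>z0\<close> moves the boundary point to 1.\<close>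
  define P where "P x = p (z0 * x)" for x
  define N where "N x = of_real (M\<^sup>2) - cnj a * P x" for x
  have P_le: "cmod (P x) \<le> M" if "cmod x \<le> 1" for x
    using le scale[OF that] by (simp add: P_def)
  have N_nz: "N x \<noteq> 0" if "cmod x \<le> 1" for x
  proof
    assume "N x = 0"
    then have "cmod (cnj a * P x) = M\<^sup>2"
      by (metis N_def eq_iff_diff_eq_0 norm_of_real abs_power2 norm_power real_norm_def power2_abs)
    moreover have "cmod (cnj a * P x) \<le> cmod a * M"
      using P_le[OF that] by (simp add: norm_mult mult_left_mono)
    moreover have "cmod a * M < M * M"
      using a M by simp
    ultimately show False
      by (simp add: power2_eq_square)
  qed
  \<comment> \<open>Where \<open>N x\<close> is nonzero, this is 1 - |w|^2 = (M^2 - |P|^2) A / |N|^2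
    for w = M (P - a) / N, cleared of denominators.\<close>
  have Pick: "(cmod (N x))\<^sup>2 - M\<^sup>2 * (cmod (P x - a))\<^sup>2 = (M\<^sup>2 - (cmod (P x))\<^sup>2) * A" for x
    unfolding N_def A_def cmod_power2 by (simp add: power2_eq_square algebra_simps)
  \<comment> \<open>This is w / x^n with the singularity at 0 removed: P - a = z0^n x^n q(z0
    x).\<close>
  define g where "g x = z0 ^ n * (of_real M * q (z0 * x)) / N x" for x
  have g_eq: "x ^ n * g x = of_real M * (P x - a) / N x" if "cmod x \<le> 1" for x
    using p[OF scale(1)[OF that]] by (simp add: g_def P_def power_mult_distrib mult_ac)
  have w_le: "cmod (x ^ n * g x) \<le> 1" if "cmod x \<le> 1" for x
  proof -
    have "M\<^sup>2 * (cmod (P x - a))\<^sup>2 \<le> (cmod (N x))\<^sup>2"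
    proof -
      have "0 \<le> (M\<^sup>2 - (cmod (P x))\<^sup>2) * A"
        using P_le[OF that] A by (intro mult_nonneg_nonneg) (auto simp: power_mono)
      with Pick[of x] show ?thesis by linarith
    qed
    then have "M * cmod (P x - a) \<le> cmod (N x)"
      using power2_le_imp_le[of "M * cmod (P x - a)"] by (simp add: power_mult_distrib)
    then show ?thesis
      using N_nz[OF that] M by (simp add: g_eq[OF that] norm_divide norm_mult divide_le_eq)
  qed
  have "g holomorphic_on cball 0 1"
    unfolding g_def
  proof (intro holomorphic_intros)
    show "(\<lambda>x. q (z0 * x)) holomorphic_on cball 0 1"
      by (rule holomorphic_on_compose_gen[OF _ q, unfolded o_def])
        (use scale in \<open>auto intro!: holomorphic_intros\<close>)
    show "N holomorphic_on cball 0 1"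
      unfolding N_def P_def
      by (intro holomorphic_intros holomorphic_on_compose_gen[OF _ p_hol, unfolded o_def])
        (use scale in \<open>auto intro!: holomorphic_intros\<close>)
  qed (use N_nz in auto)
  then have g_hol: "g holomorphic_on ball 0 1" and g_cont: "continuous_on (cball 0 1) g"
    by (auto intro: holomorphic_on_subset holomorphic_on_imp_continuous_on)
  \<comment> \<open>On the unit circle |g| = |w| \<le> 1, and the maximum modulus principle carries
    the bound inside.\<close>
  have g_le: "cmod (g x) \<le> 1" if "cmod x < 1" for x
  proof (rule maximum_modulus_frontier[of g "ball 0 1"])
    show "cmod (g y) \<le> 1" if "y \<in> frontier (ball 0 1)" for y
      using w_le[of y] that by (auto simp: norm_mult norm_power)
  qed (use g_hol g_cont that in auto)
  define b where "b = cmod (g 0)"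
  have N0: "N 0 = of_real A"
    using p[of 0] n by (simp add: power_0_left N_def P_def A_def mult.commute[of "cnj a"] flip: complex_norm_square)
  have b_eq: "b = cmod z0 ^ n * (M * cmod (q 0) / A)"
    using M A by (simp add: b_def g_def N0 norm_divide norm_mult norm_power)
  have c: "0 \<le> M * cmod (q 0) / A" "M * cmod (q 0) / A \<le> 1"
    using M A q0 by (simp_all flip: A_def)
  have r: "cmod z0 ^ n < 1"
    using z0 n by (simp add: power_less_one_iff)
  have b_le: "b \<le> M * cmod (q 0) / A"
    unfolding b_eq using r c by (intro mult_left_le_one_le) auto
  \<comment> \<open>The factor |z0|^n < 1 gives strictness even when M |q 0| = M^2 - |a|^2.\<close>
  have b1: "b < 1"
  proof -
    have "b \<le> cmod z0 ^ n" unfolding b_eq using c by (intro mult_left_le) auto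
    then show ?thesis using r by simp
  qed
  have b0: "b \<ge> 0"
    by (simp add: b_def)
  define B where "B x = x ^ n * ((b + x) / (1 + b * x))" for x :: real
  (* By Pick, F is B^2 |N|^2 - M^2 |P - a|^2, written so that both summands vanish at 1. *)
  define F where "F x = (M\<^sup>2 - (cmod (P (of_real x)))\<^sup>2) * A
      - (1 - (B x)\<^sup>2) * (cmod (N (of_real x)))\<^sup>2" for x :: real
  have F_nonneg: "0 \<le> F x" if "0 < x" "x < 1" for x
  proof -
    have x: "cmod (of_real x) < 1"
      using that by simp
    have "cmod (g (of_real x)) \<le> (b + x) / (1 + b * x)"
      using Schwarz_Pick_growth[OF g_hol g_le _ x] b1 that by (simp add: b_def)
    then have "cmod (of_real x ^ n * g (of_real x)) \<le> B x"
      using that by (simp add: B_def norm_mult norm_power mult_left_mono del: times_divide_eq_right)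
    then have "cmod (of_real M * (P (of_real x) - a) / N (of_real x)) \<le> B x"
      by (simp only: g_eq[OF less_imp_le[OF x]])
    then have "M * cmod (P (of_real x) - a) \<le> B x * cmod (N (of_real x))"
      using N_nz[of "of_real x"] M x by (simp add: norm_divide norm_mult divide_le_eq)
    then have "(M * cmod (P (of_real x) - a))\<^sup>2 \<le> (B x * cmod (N (of_real x)))\<^sup>2"
      using M by (intro power_mono) auto
    with Pick[of "of_real x"] show ?thesis
      by (simp add: F_def power_mult_distrib algebra_simps)
  qed
  have B1: "B 1 = 1"
    using b0 by (simp add: B_def)
  have F1: "F 1 = 0"
    using B1 eq by (simp add: F_def P_def)
  have "((\<lambda>x. (b + x) / (1 + b * x)) has_real_derivative
      (1 * (1 + b * 1) - (b + 1) * b) / ((1 + b * 1) * (1 + b * 1))) (at 1)"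
    using b0 by (intro DERIV_divide) (auto intro!: derivative_eq_intros)
  moreover have "(1 * (1 + b * 1) - (b + 1) * b) / ((1 + b * 1) * (1 + b * 1)) = (1 - b) / (1 + b)"
  proof -
    have "1 * (1 + b * 1) - (b + 1) * b = (1 - b) * (1 + b)"
      by (simp add: algebra_simps)
    then show ?thesis
      using b0 by simp
  qed
  ultimately have quot: "((\<lambda>x. (b + x) / (1 + b * x)) has_real_derivative (1 - b) / (1 + b)) (at 1)"
    by simp
  have B': "(B has_real_derivative (real n + (1 - b) / (1 + b))) (at 1)"
    unfolding B_def using DERIV_mult[OF DERIV_pow[of n 1] quot] b0 by (simp add: add.commute[of b 1])
  have P': "((\<lambda>x. P (of_real x)) has_vector_derivative z0 * deriv p z0) (at (1::real))"
    unfolding P_def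
  proof (rule field_vector_diff_chain_at[where f = "\<lambda>x. z0 * of_real x" and g = p, unfolded o_def])
    show "((\<lambda>x. z0 * of_real x) has_vector_derivative z0) (at (1::real))"
      by (rule derivative_eq_intros refl | simp)+
    show "(p has_field_derivative deriv p z0) (at (z0 * of_real 1))"
      using holomorphic_derivI[OF p_hol, of z0] z0 by simp
  qed
  have N': "((\<lambda>x. N (of_real x)) has_vector_derivative - cnj a * (z0 * deriv p z0)) (at (1::real))"
    unfolding N_def
    by (rule derivative_eq_intros P' refl | simp)+
  \<comment> \<open>Since B(1) = 1, the term with the derivative of |N|^2 drops out.\<close>
  have F': "(F has_real_derivative 2 * ((real n + (1 - b) / (1 + b)) * (cmod (N 1))\<^sup>2
      - A * Re (cnj (P 1) * (z0 * deriv p z0)))) (at 1)"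
    unfolding F_def
    by (rule derivative_eq_intros B' has_real_derivative_cmod_power2[OF P']
        has_real_derivative_cmod_power2[OF N'] refl)+ (simp add: B1 algebra_simps)
  \<comment> \<open>\<open>F\<close> is nonnegative to the left of 1 and vanishes at 1, so its
    derivative there cannot be positive.\<close>
  have "(real n + (1 - b) / (1 + b)) * (cmod (N 1))\<^sup>2 \<le> A * Re (cnj (P 1) * (z0 * deriv p z0))"
  proof (rule ccontr)
    assume "\<not> ?thesis"
    then obtain d where d: "d > 0" "\<And>h. 0 < h \<Longrightarrow> h < d \<Longrightarrow> F (1 - h) < F 1"
      using DERIV_pos_inc_left[OF F'] by auto
    define h where "h = min (d / 2) (1 / 2)"
    have "0 < h" "h < d" "h < 1"
      using d(1) by (auto simp: h_def)
    then show False
      using d(2)[of h] F_nonneg[of "1 - h"] F1 by auto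
  qed
  \<comment> \<open>The map b -> (1 - b) / (1 + b) is decreasing, so \<open>b_le\<close> yields a
    bound free of \<open>z0\<close>.\<close>
  moreover have "(A - M * cmod (q 0)) / (A + M * cmod (q 0)) \<le> (1 - b) / (1 + b)"
  proof -
    have "A * b \<le> M * cmod (q 0)"
      using b_le A by (simp add: field_simps)
    then have "(A - M * cmod (q 0)) * (1 + b) \<le> (1 - b) * (A + M * cmod (q 0))"
      by (simp add: algebra_simps)
    moreover have "A + M * cmod (q 0) > 0" "1 + b > 0"
      using A M b0 by (auto intro: add_pos_nonneg)
    ultimately show ?thesis
      by (simp add: pos_divide_le_eq pos_le_divide_eq)
  qed
  ultimately have "(real n + (A - M * cmod (q 0)) / (A + M * cmod (q 0))) * (cmod (N 1))\<^sup>2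
      \<le> A * Re (cnj (P 1) * (z0 * deriv p z0))"
    by (smt (verit, best) mult_right_mono zero_le_power2)
  then show ?thesis
    by (simp add: A_def N_def P_def)
qed


section \<open>The contradiction with admissibility\<close>

text \<open>Both claims are instances of this. If |p| reached M, the triple formed at a first such
  point would satisfy the conditions under which admissibility puts the value of
  \<open>\<psi>\<close> outside \<open>\<Omega>\<close>.\<close>

lemma \<Psi>_dominant:
  fixes n :: nat and M \<beta> :: real and a :: complex and p :: "complex \<Rightarrow> complex"
  assumes n: "n \<ge> 1" and a: "cmod a < M"
    and \<beta>: "0 \<le> \<beta>" "\<beta> \<le> (M\<^sup>2 - (cmod a)\<^sup>2) / M"
    and p: "p \<in> \<H> \<beta> a n"
    and \<psi>: "\<psi> \<in> \<Psi> n \<beta> \<Omega> M a D"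
    and dom: "\<And>z. z \<in> ball 0 1 \<Longrightarrow> (p z, z * deriv p z, z\<^sup>2 * deriv (deriv p) z) \<in> D \<and>
               \<psi> (p z, z * deriv p z, z\<^sup>2 * deriv (deriv p) z) \<in> \<Omega>"
    and z: "z \<in> ball 0 1"
  shows "cmod (p z) < M"
proof (rule ccontr)
  assume "\<not> cmod (p z) < M"
  have M: "M > 0"
    using a norm_ge_zero[of a] by linarith
  have p_hol: "p holomorphic_on ball 0 1"
    using p by (simp add: \<H>_def)
  then have p_cont: "continuous_on (ball 0 1) p"
    by (rule holomorphic_on_imp_continuous_on)
  obtain q where q: "q holomorphic_on ball 0 1" "q 0 = of_real \<beta>"
    and pq: "\<And>z. z \<in> ball 0 1 \<Longrightarrow> p z = a + z ^ n * q z"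
    using \<H>_factor[OF p] by blast
  \<comment> \<open>Compactness of \<open>K\<close> provides a point of least modulus among those
    with |p| \<ge> M.\<close>
  define K where "K = {w \<in> cball 0 (cmod z). M \<le> cmod (p w)}"
  have "continuous_on (cball 0 (cmod z)) (\<lambda>w. cmod (p w))"
    using z by (intro continuous_on_norm continuous_on_subset[OF p_cont]) auto
  then have "closed K"
    unfolding K_def by (intro continuous_on_closed_Collect_le) auto
  moreover have "bounded K"
    by (rule bounded_subset[OF bounded_cball[of 0 "cmod z"]]) (auto simp: K_def)
  ultimately have "compact K"
    by (simp add: compact_eq_bounded_closed)
  moreover have "z \<in> K"
    using \<open>\<not> cmod (p z) < M\<close> by (simp add: K_def)
  ultimately obtain z0 where z0: "z0 \<in> K" and z0_min: "\<And>w. w \<in> K \<Longrightarrow> cmod z0 \<le> cmod w"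
    using continuous_attains_inf[of K cmod] by (auto intro: continuous_intros)
  have z0_1: "cmod z0 < 1"
    using z0 z by (auto simp: K_def)
  have lt: "cmod (p w) < M" if "cmod w < cmod z0" for w
    using z0_min[of w] z0 that by (force simp: K_def)
  \<comment> \<open>Here p(0) = a because n \<ge> 1. Thus the open disc of radius |z0| is nonempty
    and its closure is the closed disc, to which continuity extends |p| \<le> M.\<close>
  have "z0 \<noteq> 0"
    using z0 pq[of 0] n a by (auto simp: K_def power_0_left)
  have le: "cmod (p w) \<le> M" if "cmod w \<le> cmod z0" for w
  proof (rule continuous_le_on_closure[where S = "ball 0 (cmod z0)" and f = "\<lambda>w. cmod (p w)"])
    show "continuous_on (closure (ball 0 (cmod z0))) (\<lambda>w. cmod (p w))"
      using z0_1 \<open>z0 \<noteq> 0\<close> by (intro continuous_on_norm continuous_on_subset[OF p_cont]) auto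
  qed (use lt that \<open>z0 \<noteq> 0\<close> in \<open>auto intro: less_imp_le\<close>)
  have eq: "cmod (p z0) = M"
    using le[of z0] z0 by (simp add: K_def)
  define r where "r = p z0"
  define s where "s = z0 * deriv p z0"
  define t where "t = z0\<^sup>2 * deriv (deriv p) z0"
  define \<theta> where "\<theta> = Arg r"
  have r: "r = of_real M * cis \<theta>"
    using rcis_cmod_Arg[of r] eq by (simp add: r_def \<theta>_def rcis_def)
  define A where "A = M\<^sup>2 - (cmod a)\<^sup>2"
  define L where "L = (cmod (of_real M - cnj a * cis \<theta>))\<^sup>2"
  define \<mu> where "\<mu> = real n + (A - M * \<beta>) / (A + M * \<beta>)"
  \<comment> \<open>As |r| = M, \<open>k\<close> is the real part of s / r, which turns out to be
    real. The choice of \<open>m\<close> makes m L / A equal to \<open>k\<close>, matching both the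
    formula for \<open>s\<close> and the bound on Re (t / s + 1) in the definition of
    \<open>\<Psi>\<close>.\<close>
  define k where "k = Re (cnj r * s) / M\<^sup>2"
  define m where "m = k * A / L"
  have A: "A > 0"
    using a by (simp add: A_def power_strict_mono)
  have M\<beta>: "M * \<beta> \<le> A"
    using \<beta>(2) M by (simp add: A_def field_simps)
  have L: "L > 0"
  proof -
    have "cmod (cnj a * cis \<theta>) < cmod (of_real M)"
      using a M by (simp add: norm_mult)
    then have "of_real M \<noteq> cnj a * cis \<theta>"
      by (metis less_irrefl)
    then show ?thesis
      by (simp add: L_def)
  qed
  \<comment> \<open>Positivity of \<open>\<mu>\<close> forces k > 0 and hence s \<noteq> 0, so that
    t / s is a genuine quotient.\<close>
  have "\<mu> > 0"
    using n M\<beta> \<beta>(1) A M by (auto simp: \<mu>_def intro!: add_pos_nonneg divide_nonneg_pos)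
  have "\<mu> * (cmod (of_real (M\<^sup>2) - cnj a * r))\<^sup>2 \<le> A * (M\<^sup>2 * k)"
    using boundary_derivative_bound[OF q(1) pq n a z0_1 le eq] q(2) \<beta>(1) M\<beta> M
    by (simp add: A_def \<mu>_def r_def s_def k_def)
  moreover have "(cmod (of_real (M\<^sup>2) - cnj a * r))\<^sup>2 = M\<^sup>2 * L"
  proof -
    have "of_real (M\<^sup>2) - cnj a * r = of_real M * (of_real M - cnj a * cis \<theta>)"
      by (simp add: r power2_eq_square algebra_simps)
    then show ?thesis
      using M by (simp only: L_def norm_mult power_mult_distrib norm_of_real power2_abs)
  qed
  ultimately have \<mu>k: "\<mu> * L \<le> k * A"
    using M by (simp add: mult.left_commute mult_ac)
  then have m: "\<mu> \<le> m"
    using L by (simp add: m_def pos_le_divide_eq)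
  have "0 < \<mu> * L"
    using \<open>\<mu> > 0\<close> L by simp
  with \<mu>k have "0 < k * A"
    by linarith
  then have k: "k > 0"
    using A by (simp add: zero_less_mult_iff)
  have kL: "m * (L / A) = k"
    using A L by (simp add: m_def)
  have sub: "cball 0 (cmod z0) \<subseteq> ball 0 1"
    using z0_1 by auto
  have max: "cmod (p w) \<le> cmod (p z0)" if "cmod w = cmod z0" for w
    using le[of w] that eq by simp
  note circ = circle_max_derivatives[OF p_hol open_ball sub max, folded r_def s_def t_def]
  have rr: "r * cnj r = of_real (M\<^sup>2)"
    using eq by (simp add: r_def complex_norm_square[symmetric])
  have "cnj r * s = of_real (k * M\<^sup>2)"
    using circ(1) M by (simp add: k_def complex_eq_iff)
  then have "r * cnj r * s = of_real (k * M\<^sup>2) * r"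
    by (simp add: mult_ac)
  then have s: "s = of_real k * r"
    using M by (simp add: rr)
  have "s \<noteq> 0"
    using k M r by (auto simp: s)
  \<comment> \<open>This is the second-order condition on the circle divided by k M^2 > 0.\<close>
  have "k \<le> Re (t / s + 1)"
  proof -
    have "cnj r * (s + t) = cnj r * s * (t / s + 1)"
      using \<open>s \<noteq> 0\<close> by (simp add: field_simps)
    also have "\<dots> = of_real (k * M\<^sup>2) * (t / s + 1)"
      by (simp only: \<open>cnj r * s = _\<close>)
    finally have "Re (cnj r * (s + t)) = k * M\<^sup>2 * Re (t / s + 1)"
      by (simp only: Re_complex_of_real Im_complex_of_real times_complex.simps)
    moreover have "(cmod s)\<^sup>2 = k * M\<^sup>2 * k"
      using eq by (simp add: s norm_mult power_mult_distrib r_def power2_eq_square)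
    ultimately have "k * M\<^sup>2 * k \<le> k * M\<^sup>2 * Re (t / s + 1)"
      using circ(2) by simp
    then show ?thesis
      using k M by (simp add: mult_le_cancel_left)
  qed
  moreover have "s = of_real (m * (M * L / A)) * cis \<theta>"
  proof -
    have "m * (M * L / A) = k * M"
      by (simp flip: kL)
    then show ?thesis
      by (simp add: s r)
  qed
  moreover have "(r, s, t) \<in> D" "\<psi> (r, s, t) \<in> \<Omega>"
    using dom[of z0] z0_1 by (auto simp: r_def s_def t_def)
  ultimately show False
    using \<psi>[unfolded \<Psi>_def mem_Collect_eq, THEN conjunct2, THEN conjunct2, THEN conjunct2,
        THEN conjunct2, rule_format, of r s t m \<theta>, folded A_def L_def, folded \<mu>_def] m r
    by (simp only: kL)
qed

theorem theorem3p3: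
  fixes n :: nat and M \<beta> :: real and a :: complex and p :: "complex \<Rightarrow> complex"
  assumes "n \<ge> 1" and "M > 0" and "cmod a < M"
    and "0 < \<beta>" and "\<beta> \<le> (M\<^sup>2 - (cmod a)\<^sup>2) / M"
    and "p \<in> \<H> \<beta> a n"
  shows "(\<forall>\<Omega> D \<psi>. is_domain \<Omega> \<longrightarrow> \<psi> \<in> \<Psi> n \<beta> \<Omega> M a D \<longrightarrow>
            (\<forall>z\<in>ball 0 1. (p z, z * deriv p z, z\<^sup>2 * deriv (deriv p) z) \<in> D \<and>
               \<psi> (p z, z * deriv p z, z\<^sup>2 * deriv (deriv p) z) \<in> \<Omega>) \<longrightarrow>
            (\<forall>z\<in>ball 0 1. cmod (p z) < M))
       \<and> (\<forall>D \<psi>. \<psi> \<in> \<Psi>_disc n \<beta> M a D \<longrightarrow>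
            (\<forall>z\<in>ball 0 1. (p z, z * deriv p z, z\<^sup>2 * deriv (deriv p) z) \<in> D \<and>
               cmod (\<psi> (p z, z * deriv p z, z\<^sup>2 * deriv (deriv p) z)) < M) \<longrightarrow>
            (\<forall>z\<in>ball 0 1. cmod (p z) < M))"
proof (intro conjI allI impI ballI)
  fix \<Omega> D \<psi> and z :: complex
  assume "\<psi> \<in> \<Psi> n \<beta> \<Omega> M a D" and "z \<in> ball 0 1"
    and "\<forall>z\<in>ball 0 1. (p z, z * deriv p z, z\<^sup>2 * deriv (deriv p) z) \<in> D \<and>
               \<psi> (p z, z * deriv p z, z\<^sup>2 * deriv (deriv p) z) \<in> \<Omega>"
  with assms show "cmod (p z) < M"
    by (intro \<Psi>_dominant[of n a M \<beta> p \<psi> \<Omega> D]) auto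
next
  fix D \<psi> and z :: complex
  assume "\<psi> \<in> \<Psi>_disc n \<beta> M a D" and "z \<in> ball 0 1"
    and "\<forall>z\<in>ball 0 1. (p z, z * deriv p z, z\<^sup>2 * deriv (deriv p) z) \<in> D \<and>
               cmod (\<psi> (p z, z * deriv p z, z\<^sup>2 * deriv (deriv p) z)) < M"
  with assms show "cmod (p z) < M"
    by (intro \<Psi>_dominant[of n a M \<beta> p \<psi> "{w. cmod w < M}" D]) (auto simp: \<Psi>_disc_def)
qed

end
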